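(* For every fixed prime power $q\ge 5$ there is a constant $C_q$ such that $\chi_q(n) \le n/2 + C_q$ for all integers $n\ge 1$; and for $q\in\{3,4\}$ there is a constant $C_q$ such that $\chi_q(n)\le 3n/5 + C_q$ for all integers $n\ge1$.
   Context: For a prime power $q$ and integer $n\ge 1$, $\mathrm{PG}(n-1,q)$ is the projective space whose points are the $1$-dimensional subspaces of $\mathbb{F}_q^n$ and whose lines are the sets of points contained in $2$-dimensional subspaces. $\chi_q(n)$ denotes the minimum number of colors needed to color the points of $\mathrm{PG}(n-1,q)$ so that no line is monochromatic. *)

theory Defs
  imports "HOL-Algebra.Ring" "HOL-Algebra.Coset" "HOL-Library.FuncSet" "HOL-Number_Theory.Prime_Powers"
begin

(* The coordinate space F^n. The dimension n varies inside the statements, so vectors are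
   extensional functions on {..<n} rather than elements of a type. *)
definition vecs :: "('a, 'm) ring_scheme \<Rightarrow> nat \<Rightarrow> (nat \<Rightarrow> 'a) set" where
  "vecs F n = {..<n} \<rightarrow>\<^sub>E carrier F"

definition zero_vec :: "('a, 'm) ring_scheme \<Rightarrow> nat \<Rightarrow> nat \<Rightarrow> 'a" where
  "zero_vec F n = (\<lambda>j\<in>{..<n}. \<zero>\<^bsub>F\<^esub>)"

definition lincomb ::
    "('a, 'm) ring_scheme \<Rightarrow> nat \<Rightarrow> nat \<Rightarrow> (nat \<Rightarrow> 'a) \<Rightarrow> (nat \<Rightarrow> nat \<Rightarrow> 'a) \<Rightarrow> nat \<Rightarrow> 'a" where
  "lincomb F n d c b = (\<lambda>j\<in>{..<n}. \<Oplus>\<^bsub>F\<^esub>i\<in>{..<d}. c i \<otimes>\<^bsub>F\<^esub> b i j)"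

definition lin_indep ::
    "('a, 'm) ring_scheme \<Rightarrow> nat \<Rightarrow> nat \<Rightarrow> (nat \<Rightarrow> nat \<Rightarrow> 'a) \<Rightarrow> bool" where
  "lin_indep F n d b \<longleftrightarrow>
     (\<forall>c \<in> {..<d} \<rightarrow> carrier F. lincomb F n d c b = zero_vec F n \<longrightarrow> (\<forall>i<d. c i = \<zero>\<^bsub>F\<^esub>))"

definition lin_span ::
    "('a, 'm) ring_scheme \<Rightarrow> nat \<Rightarrow> nat \<Rightarrow> (nat \<Rightarrow> nat \<Rightarrow> 'a) \<Rightarrow> (nat \<Rightarrow> 'a) set" where
  "lin_span F n d b = (\<lambda>c. lincomb F n d c b) ` ({..<d} \<rightarrow> carrier F)"

(* The d-dimensional subspaces of F^n: those having a basis b 0, ..., b (d - 1). *)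
definition subspaces_of_dim :: "('a, 'm) ring_scheme \<Rightarrow> nat \<Rightarrow> nat \<Rightarrow> (nat \<Rightarrow> 'a) set set" where
  "subspaces_of_dim F n d =
     {lin_span F n d b | b. b \<in> {..<d} \<rightarrow> vecs F n \<and> lin_indep F n d b}"

(* Points and lines of PG(n - 1, q), where q is the order of F. *)
definition PG_points :: "('a, 'm) ring_scheme \<Rightarrow> nat \<Rightarrow> (nat \<Rightarrow> 'a) set set" where
  "PG_points F n = subspaces_of_dim F n 1"

definition PG_lines :: "('a, 'm) ring_scheme \<Rightarrow> nat \<Rightarrow> (nat \<Rightarrow> 'a) set set set" where
  "PG_lines F n = {{P \<in> PG_points F n. P \<subseteq> W} | W. W \<in> subspaces_of_dim F n 2}"

definition monochromatic :: "('p \<Rightarrow> nat) \<Rightarrow> 'p set \<Rightarrow> bool" where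
  "monochromatic f L \<longleftrightarrow> (\<exists>k. \<forall>P\<in>L. f P = k)"

definition line_colouring ::
    "('a, 'm) ring_scheme \<Rightarrow> nat \<Rightarrow> nat \<Rightarrow> ((nat \<Rightarrow> 'a) set \<Rightarrow> nat) \<Rightarrow> bool" where
  "line_colouring F n k f \<longleftrightarrow>
     f \<in> PG_points F n \<rightarrow> {..<k} \<and> (\<forall>L\<in>PG_lines F n. \<not> monochromatic f L)"

(* The minimum is attained for every finite field F: there are finitely many points, and
   colouring them with distinct colours works since every line has at least two points. *)
definition chi :: "('a, 'm) ring_scheme \<Rightarrow> nat \<Rightarrow> nat" where
  "chi F n = (LEAST k. \<exists>f. line_colouring F n k f)"

end

theory Submission imports Defs begin

text \<open>
  Over a field F with at least 3 elements, two more dimensions cost one more colour. Suppose that the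
  points of F^n are coloured without monochromatic lines and that a quadratic form Q has no zero of colour 0. Write a vector of F^(n + 2) as (p, e, t) with p in F^n.
  A point with e \<noteq> 0 gets colour 0 if t e + Q(p) = e^2 and a new colour otherwise; a point with
  e = 0 and p \<noteq> 0 keeps the colour of p; the point d = (0, 0, 1) gets the new colour. The form
  t e + Q(p) again has no zero of colour 0. A line in the hyperplane e = 0 either contains d or
  projects to a line of F^n. Any other line meets that hyperplane in one point x. If x = d, then
  t e + Q(p) = e^2 has a solution on the line; if x = (p, 0, t) has colour 0, then all points of the
  line having colour 0 would give a quadratic polynomial with leading coefficient Q(p) \<noteq> 0 vanishing
  on the whole field.
\<close>

section \<open>A sum of hyperbolic planes, plus one square in odd dimension, and the colouring built
  on it\<close>

fun quad :: "('a, 'm) ring_scheme \<Rightarrow> nat \<Rightarrow> (nat \<Rightarrow> 'a) \<Rightarrow> 'a" where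
  "quad F 0 v = \<zero>\<^bsub>F\<^esub>"
| "quad F (Suc 0) v = v 0 \<otimes>\<^bsub>F\<^esub> v 0"
| "quad F (Suc (Suc n)) v = v n \<otimes>\<^bsub>F\<^esub> v (Suc n) \<oplus>\<^bsub>F\<^esub> quad F n v"

text \<open>Coordinates \<open>n\<close> and \<open>Suc n\<close> play the roles of e and t. Only
  colour 0 is reused from step to step; \<open>Suc (n div 2)\<close> is fresh because dimension
  \<open>n\<close> uses colours up to \<open>n div 2\<close> (\<open>quad_colour_le\<close>). In
  dimension 1 the single point has colour 0, and its square is nonzero. The value at the zero vector
  has no meaning: it spans no point.\<close>

fun quad_colour :: "('a, 'm) ring_scheme \<Rightarrow> nat \<Rightarrow> (nat \<Rightarrow> 'a) \<Rightarrow> nat" where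
  "quad_colour F 0 v = 0"
| "quad_colour F (Suc 0) v = 0"
| "quad_colour F (Suc (Suc n)) v =
     (if v n \<noteq> \<zero>\<^bsub>F\<^esub> then
        (if quad F (Suc (Suc n)) v = v n \<otimes>\<^bsub>F\<^esub> v n then 0 else Suc (n div 2))
      else if \<exists>j<n. v j \<noteq> \<zero>\<^bsub>F\<^esub> then quad_colour F n v else Suc (n div 2))"

lemma quad_cong: "(\<And>j. j < n \<Longrightarrow> u j = v j) \<Longrightarrow> quad F n u = quad F n v"
  by (induction F n u rule: quad.induct) auto

lemma quad_colour_cong:
  "(\<And>j. j < n \<Longrightarrow> u j = v j) \<Longrightarrow> quad_colour F n u = quad_colour F n v"
proof (induction F n u rule: quad_colour.induct)
  case (3 F n u)
  moreover have "quad F (Suc (Suc n)) u = quad F (Suc (Suc n)) v"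
    using 3(2) by (rule quad_cong)
  moreover have "(\<exists>j<n. u j \<noteq> \<zero>\<^bsub>F\<^esub>) \<longleftrightarrow> (\<exists>j<n. v j \<noteq> \<zero>\<^bsub>F\<^esub>)"
    using 3(2) by (metis less_SucI)
  ultimately show ?case by auto
qed simp_all

lemma quad_colour_le: "quad_colour F n v \<le> n div 2"
  by (induction F n v rule: quad_colour.induct) (auto intro: le_SucI)

section \<open>Scaling, expansion along a line, and zeros of the form\<close>

context field
begin

lemma quad_closed [simp]: "v \<in> {..<n} \<rightarrow> carrier R \<Longrightarrow> quad R n v \<in> carrier R"
  by (induction n rule: induct_nat_012) (auto simp: Pi_iff)

lemma quad_scale:
  assumes a: "a \<in> carrier R" and v: "v \<in> {..<n} \<rightarrow> carrier R"
  shows "quad R n (\<lambda>j. a \<otimes> v j) = (a \<otimes> a) \<otimes> quad R n v"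
  using v
proof (induction n rule: induct_nat_012)
  case 0 then show ?case using a by simp
next
  case 1 then show ?case using a by (simp add: Pi_iff m_ac)
next
  case (ge2 n)
  then have c: "v n \<in> carrier R" "v (Suc n) \<in> carrier R" "quad R n v \<in> carrier R"
    by (auto simp: Pi_iff intro!: quad_closed)
  have "quad R n (\<lambda>j. a \<otimes> v j) = (a \<otimes> a) \<otimes> quad R n v" using ge2 by (auto simp: Pi_iff)
  then show ?case using a c by (simp add: r_distr m_ac)
qed

text \<open>The witness \<open>b\<close> is the polar form at \<open>u\<close> and \<open>v\<close>.
  What matters is that it is chosen before \<open>t\<close>: the form becomes a polynomial of degree
  at most two in \<open>t\<close> with leading coefficient \<open>quad R n v\<close>.\<close>

lemma quad_add_scale:
  assumes u: "u \<in> {..<n} \<rightarrow> carrier R" and v: "v \<in> {..<n} \<rightarrow> carrier R"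
  shows "\<exists>b\<in>carrier R. \<forall>t\<in>carrier R.
    quad R n (\<lambda>j. u j \<oplus> t \<otimes> v j) = quad R n u \<oplus> t \<otimes> b \<oplus> (t \<otimes> t) \<otimes> quad R n v"
  using u v
proof (induction n rule: induct_nat_012)
  case 0 then show ?case by (auto intro: bexI[of _ \<zero>])
next
  case 1
  then have c: "u 0 \<in> carrier R" "v 0 \<in> carrier R" by auto
  \<comment> \<open>Twice the product, written as a sum so that it is also right in characteristic
    2.\<close>
  show ?case
    by (rule bexI[of _ "u 0 \<otimes> v 0 \<oplus> u 0 \<otimes> v 0"]) (use c in \<open>auto simp: r_distr l_distr a_ac m_ac\<close>)
next
  case (ge2 n)
  then have c: "u n \<in> carrier R" "u (Suc n) \<in> carrier R" "quad R n u \<in> carrier R"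
     "v n \<in> carrier R" "v (Suc n) \<in> carrier R" "quad R n v \<in> carrier R"
    by (auto simp: Pi_iff intro!: quad_closed)
  obtain b where b: "b \<in> carrier R" "\<And>t. t\<in>carrier R \<Longrightarrow>
    quad R n (\<lambda>j. u j \<oplus> t \<otimes> v j) = quad R n u \<oplus> t \<otimes> b \<oplus> (t \<otimes> t) \<otimes> quad R n v"
    using ge2 by (auto simp: Pi_iff)
  show ?case
    by (rule bexI[of _ "u n \<otimes> v (Suc n) \<oplus> u (Suc n) \<otimes> v n \<oplus> b"])
       (use b c in \<open>auto simp: r_distr l_distr a_ac m_ac\<close>)
qed

text \<open>Both sides of the equation defining colour 0 are homogeneous of degree two, so the
  factor \<open>a \<otimes> a\<close> cancels. This makes the colour a function of projective
  points.\<close>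

lemma quad_colour_scale:
  assumes a: "a \<in> carrier R" "a \<noteq> \<zero>" and v: "v \<in> {..<n} \<rightarrow> carrier R"
  shows "quad_colour R n (\<lambda>j. a \<otimes> v j) = quad_colour R n v"
  using v
proof (induction n rule: induct_nat_012)
  case (ge2 n)
  have c: "v j \<in> carrier R" if "j < Suc (Suc n)" for j using ge2.prems that by auto
  have z: "a \<otimes> v j = \<zero> \<longleftrightarrow> v j = \<zero>" if "j < Suc (Suc n)" for j
    using c[OF that] a by (simp add: integral_iff)
  have "quad R (Suc (Suc n)) (\<lambda>j. a \<otimes> v j) = (a \<otimes> v n) \<otimes> (a \<otimes> v n)
      \<longleftrightarrow> (a \<otimes> a) \<otimes> quad R (Suc (Suc n)) v = (a \<otimes> a) \<otimes> (v n \<otimes> v n)"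
    unfolding quad_scale[OF a(1) ge2.prems] using a(1) c[of n] by (simp add: m_ac)
  also have "\<dots> \<longleftrightarrow> quad R (Suc (Suc n)) v = v n \<otimes> v n"
    using a c[of n] quad_closed[OF ge2.prems] by (intro m_lcancel) (auto simp: integral_iff)
  finally have q: "quad R (Suc (Suc n)) (\<lambda>j. a \<otimes> v j) = (a \<otimes> v n) \<otimes> (a \<otimes> v n)
      \<longleftrightarrow> quad R (Suc (Suc n)) v = v n \<otimes> v n" .
  have e: "(\<exists>j<n. a \<otimes> v j \<noteq> \<zero>) \<longleftrightarrow> (\<exists>j<n. v j \<noteq> \<zero>)"
    using z by (meson less_SucI)
  have "quad_colour R n (\<lambda>j. a \<otimes> v j) = quad_colour R n v" using ge2.IH(1) c by (auto simp: Pi_iff)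
  then show ?case
    unfolding quad_colour.simps(3) by (simp only: z[of n, simplified] q e) 
qed simp_all

text \<open>If e is nonzero, colour 0 makes the form equal to the nonzero square of e. If e = 0, the
  new hyperbolic plane contributes nothing, and colour 0 can only be inherited from a nonzero
  projection.\<close>

lemma quad_nonzero:
  assumes "v \<in> {..<n} \<rightarrow> carrier R" "\<exists>j<n. v j \<noteq> \<zero>" "quad_colour R n v = 0"
  shows "quad R n v \<noteq> \<zero>"
  using assms
proof (induction n rule: induct_nat_012)
  case 1 then show ?case by (auto simp: integral_iff Pi_iff)
next
  case (ge2 n)
  have c: "v j \<in> carrier R" if "j < Suc (Suc n)" for j using ge2.prems that by auto
  show ?case
  proof (cases "v n = \<zero>")
    case True
    moreover have "v \<in> {..<n} \<rightarrow> carrier R" using c by auto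
    ultimately have "quad R n v \<noteq> \<zero>"
      using ge2.IH(1) ge2.prems(3) by (auto split: if_splits)
    then show ?thesis using True c[of "Suc n"] \<open>v \<in> {..<n} \<rightarrow> carrier R\<close> by simp
  next
    case False
    then show ?thesis using ge2.prems(3) c[of n] by (auto simp: integral_iff split: if_splits)
  qed
qed simp

text \<open>The roots 0 and 1 force \<open>c = \<zero>\<close> and \<open>b = \<ominus> a\<close>;
  the root \<open>s\<close> then gives s (s - 1) a = 0. This is where a third field element
  enters.\<close>

lemma quadratic_three_roots:
  assumes c: "a \<in> carrier R" "b \<in> carrier R" "c \<in> carrier R" "s \<in> carrier R" "s \<noteq> \<zero>" "s \<noteq> \<one>"
    and root: "\<And>t. t \<in> carrier R \<Longrightarrow> c \<oplus> t \<otimes> b \<oplus> (t \<otimes> t) \<otimes> a = \<zero>"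
  shows "a = \<zero>"
proof -
  have c0: "c = \<zero>" using root[of \<zero>] c by simp
  have b: "b = \<ominus> a" using root[of \<one>] c c0 by (simp add: minus_equality)
  have "s \<otimes> \<ominus> a \<oplus> (s \<otimes> s) \<otimes> a = \<zero>" using root[of s] c c0 b by simp
  then have "(s \<otimes> (s \<ominus> \<one>)) \<otimes> a = \<zero>" 
    using c by (simp add: minus_eq r_distr l_distr r_minus l_minus a_ac m_ac)
  moreover have "s \<ominus> \<one> \<noteq> \<zero>" using c sum_zero_eq_neg[of s "\<ominus> \<one>"] by (auto simp: minus_eq)
  ultimately show ?thesis using c by (simp add: integral_iff)
qed

section \<open>Planes of vectors are never monochromatic\<close>

definition indep_pair :: "nat \<Rightarrow> (nat \<Rightarrow> 'a) \<Rightarrow> (nat \<Rightarrow> 'a) \<Rightarrow> bool" where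
  "indep_pair n u v \<longleftrightarrow> (\<forall>a\<in>carrier R. \<forall>b\<in>carrier R.
     (\<forall>j<n. a \<otimes> u j \<oplus> b \<otimes> v j = \<zero>) \<longrightarrow> a = \<zero> \<and> b = \<zero>)"

lemma indep_pairD:
  assumes "indep_pair n u v" "a \<in> carrier R" "b \<in> carrier R" "a \<noteq> \<zero> \<or> b \<noteq> \<zero>"
  shows "\<exists>j<n. a \<otimes> u j \<oplus> b \<otimes> v j \<noteq> \<zero>"
  using assms unfolding indep_pair_def by blast

text \<open>Applied to one coordinate of two vectors, it yields a combination in the hyperplane
  where that coordinate vanishes. The pair (y, -x) works unless both entries are zero.\<close>

lemma kernel_pair:
  assumes "x \<in> carrier R" "y \<in> carrier R"
  obtains a b where "a \<in> carrier R" "b \<in> carrier R" "a \<noteq> \<zero> \<or> b \<noteq> \<zero>" "a \<otimes> x \<oplus> b \<otimes> y = \<zero>"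
proof (cases "x = \<zero> \<and> y = \<zero>")
  case True then show ?thesis using that[of \<one> \<zero>] by auto
next
  case False
  have "y \<otimes> x \<oplus> (\<ominus> x) \<otimes> y = \<zero>" using assms by (simp add: l_minus r_minus m_comm r_neg)
  then show ?thesis using that[of y "\<ominus> x"] assms False by auto
qed

lemma not_indep_pair_single:
  assumes "i < n" "u i \<in> carrier R" "v i \<in> carrier R"
    and "\<And>j. j < n \<Longrightarrow> j \<noteq> i \<Longrightarrow> u j = \<zero> \<and> v j = \<zero>"
  shows "\<not> indep_pair n u v"
proof
  assume I: "indep_pair n u v"
  obtain a b where ab: "a \<in> carrier R" "b \<in> carrier R" "a \<noteq> \<zero> \<or> b \<noteq> \<zero>"
      "a \<otimes> u i \<oplus> b \<otimes> v i = \<zero>"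
    using kernel_pair assms(2,3) by blast
  obtain j where j: "j < n" "a \<otimes> u j \<oplus> b \<otimes> v j \<noteq> \<zero>"
    using indep_pairD[OF I ab(1-3)] by blast
  show False using j assms(4)[of j] ab by (cases "j = i") auto
qed

text \<open>Vectors are plain functions of which only the first \<open>n\<close> coordinates count,
  so projecting away the last two merely lowers \<open>n\<close>. The induction can therefore keep
  the same \<open>L\<close>, \<open>u\<close> and \<open>v\<close>.\<close>

lemma no_monochromatic_plane:
  assumes three: "s \<in> carrier R" "s \<noteq> \<zero>" "s \<noteq> \<one>"
    and L: "\<And>w. w \<in> L \<Longrightarrow> w \<in> {..<n} \<rightarrow> carrier R"
    and closed: "\<And>a b u v. a \<in> carrier R \<Longrightarrow> b \<in> carrier R \<Longrightarrow> u \<in> L \<Longrightarrow> v \<in> L \<Longrightarrow>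
      (\<lambda>j. a \<otimes> u j \<oplus> b \<otimes> v j) \<in> L"
    and uv: "u \<in> L" "v \<in> L" "indep_pair n u v"
    and mono: "\<And>w. w \<in> L \<Longrightarrow> \<exists>j<n. w j \<noteq> \<zero> \<Longrightarrow> quad_colour R n w = k"
  shows False
  using L uv(3) mono
proof (induction n rule: induct_nat_012)
  case 0
  then show ?case using indep_pairD[of 0 u v \<one> \<zero>] by auto
next
  case 1
  then show ?case using not_indep_pair_single[of 0 1 u v] uv by (auto simp: Pi_iff)
next
  case (ge2 n)
  have c: "w j \<in> carrier R" if "w \<in> L" "j < Suc (Suc n)" for w j using ge2.prems(1) that by auto
  have nz: "\<exists>j<n. w j \<noteq> \<zero>" 
    if "\<exists>j<Suc (Suc n). w j \<noteq> \<zero>" "w n = \<zero>" "w (Suc n) = \<zero>" for w :: "nat \<Rightarrow> 'a"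
    using that by (metis less_Suc_eq)
  show ?case
  proof (cases "\<forall>w\<in>L. w n = \<zero>")
    case flat: True
    show False
    \<comment> \<open>Does the line inside e = 0 contain the point d?\<close>
    proof (cases "\<exists>w\<in>L. w (Suc n) \<noteq> \<zero> \<and> (\<forall>j<n. w j = \<zero>)")
      case True
      then obtain w where w: "w \<in> L" "w (Suc n) \<noteq> \<zero>" "\<forall>j<n. w j = \<zero>" by blast
      have "quad_colour R (Suc (Suc n)) w = k" using w by (intro ge2.prems(3)) auto
      then have k: "k = Suc (n div 2)" using w(3) bspec[OF flat w(1)] by (auto split: if_splits)
      \<comment> \<open>A vector with nonzero projection would have an old colour, at most
        \<open>n div 2\<close>, while d has the fresh one. So all of \<open>L\<close> lies on the
        axis through d, too small for an independent pair.\<close>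
      have zero: "x j = \<zero>" if x: "x \<in> L" and j: "j < n" for x j
      proof (rule ccontr)
        assume "x j \<noteq> \<zero>"
        then have e: "\<exists>j<n. x j \<noteq> \<zero>" using j by blast
        then have "quad_colour R (Suc (Suc n)) x = k" using x by (intro ge2.prems(3)) (auto dest: less_SucI)
        then have "quad_colour R n x = k" using e bspec[OF flat x] by simp
        then show False using quad_colour_le[of R n x] k by simp
      qed
      have "\<not> indep_pair (Suc (Suc n)) u v"
      proof (rule not_indep_pair_single[of "Suc n"])
        fix j assume "j < Suc (Suc n)" "j \<noteq> Suc n"
        then have "j < n \<or> j = n" by linarith
        then show "u j = \<zero> \<and> v j = \<zero>" using zero flat uv(1,2) by blast
      qed (use c uv in auto)
      then show False using ge2.prems(2) by simp
    next
      case False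
      then have last: "w (Suc n) = \<zero>" if "w \<in> L" "\<forall>j<n. w j = \<zero>" for w
        using that by blast
      \<comment> \<open>Without d in \<open>L\<close>, a combination with zero projection is zero in
        all coordinates, so projection is injective on the plane.\<close>
      have ind: "indep_pair n u v"
        unfolding indep_pair_def
      proof (intro ballI impI)
        fix a b assume ab: "a \<in> carrier R" "b \<in> carrier R" "\<forall>j<n. a \<otimes> u j \<oplus> b \<otimes> v j = \<zero>"
        have m: "(\<lambda>j. a \<otimes> u j \<oplus> b \<otimes> v j) \<in> L" using closed ab uv by blast
        have "a \<otimes> u n \<oplus> b \<otimes> v n = \<zero>" using bspec[OF flat m] .
        moreover have "a \<otimes> u (Suc n) \<oplus> b \<otimes> v (Suc n) = \<zero>" using last[OF m ab(3)] .
        ultimately have "\<forall>j<Suc (Suc n). a \<otimes> u j \<oplus> b \<otimes> v j = \<zero>"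
          using ab(3) by (auto simp: less_Suc_eq)
        then show "a = \<zero> \<and> b = \<zero>" using ge2.prems(2) ab unfolding indep_pair_def by blast
      qed
      show False
      proof (rule ge2.IH(1)[OF _ ind])
        show "w \<in> {..<n} \<rightarrow> carrier R" if "w \<in> L" for w using c that by auto
        show "quad_colour R n w = k" if w: "w \<in> L" "\<exists>j<n. w j \<noteq> \<zero>" for w
        proof -
          have "\<exists>j<Suc (Suc n). w j \<noteq> \<zero>" using w(2) by (meson less_SucI)
          then show ?thesis using ge2.prems(3)[OF w(1)] w(2) bspec[OF flat w(1)] by simp
        qed
      qed
    qed
  next
    case False
    then obtain p1 where p1: "p1 \<in> L" "p1 n \<noteq> \<zero>" by blast
    obtain a b where ab: "a \<in> carrier R" "b \<in> carrier R" "a \<noteq> \<zero> \<or> b \<noteq> \<zero>"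
      "a \<otimes> u n \<oplus> b \<otimes> v n = \<zero>"
      using kernel_pair[of "u n" "v n"] c uv by auto
    \<comment> \<open>A nonzero vector of the plane in the hyperplane e = 0. Adding its multiples to
      \<open>p1\<close> keeps e constant and stays off that hyperplane.\<close>
    define p0 where "p0 = (\<lambda>j. a \<otimes> u j \<oplus> b \<otimes> v j)"
    have p0: "p0 \<in> L" "p0 n = \<zero>" "\<exists>j<Suc (Suc n). p0 j \<noteq> \<zero>"
      using closed[OF ab(1,2) uv(1,2)] ab(4) indep_pairD[OF ge2.prems(2) ab(1-3)]
      unfolding p0_def by auto
    define q where "q t = (\<lambda>j. p1 j \<oplus> t \<otimes> p0 j)" for t
    have cc: "p0 j \<in> carrier R" "p1 j \<in> carrier R" if "j < Suc (Suc n)" for j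
      using c p0 p1 that by auto
    have cq: "quad R n p1 \<in> carrier R" "quad R n p0 \<in> carrier R" using cc by (auto intro!: quad_closed)
    have q: "q t n = p1 n \<and> quad_colour R (Suc (Suc n)) (q t) = k"
      if t: "t \<in> carrier R" for t
    proof -
      \<comment> \<open>Membership in \<open>L\<close> is known for formal combinations. Beyond the
        first \<open>n + 2\<close> coordinates the entries need not lie in the carrier, so
        \<open>x\<close> and \<open>q t\<close> are only identified up to
        \<open>quad_colour_cong\<close>.\<close>
      define x where "x = (\<lambda>j. \<one> \<otimes> p1 j \<oplus> t \<otimes> p0 j)"
      have x: "x \<in> L" unfolding x_def using closed p0 p1 t by blast
      have xq: "x j = q t j" if "j < Suc (Suc n)" for j
        using cc[OF that] by (simp add: x_def q_def)
      have qn: "q t n = p1 n" using t cc p0(2) by (simp add: q_def)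
      then have "x n \<noteq> \<zero>" using p1(2) xq by simp
      then have "quad_colour R (Suc (Suc n)) x = k" using x by (intro ge2.prems(3)) (auto intro: exI[of _ n])
      then show ?thesis using qn quad_colour_cong[of "Suc (Suc n)" x "q t" R] xq by simp
    qed
    define e y z A B where "e = p1 n" and "y = p1 (Suc n)" and "z = p0 (Suc n)"
      and "A = quad R n p0" and "B = quad R n p1"
    note defs = e_def y_def z_def A_def B_def
    have ce: "e \<in> carrier R" "y \<in> carrier R" "z \<in> carrier R" "A \<in> carrier R" "B \<in> carrier R"
      "e \<noteq> \<zero>"
      using cc cq p1 unfolding defs by auto
    have quad_q: "quad R (Suc (Suc n)) (q t) = e \<otimes> (y \<oplus> t \<otimes> z) \<oplus> quad R n (q t)"
      if "t \<in> carrier R" for t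
      using q[OF that] by (simp add: defs) (simp add: q_def)
    have colour_q: "k = (if e \<otimes> (y \<oplus> t \<otimes> z) \<oplus> quad R n (q t) = e \<otimes> e then 0 else Suc (n div 2))"
      if "t \<in> carrier R" for t
      using q[OF that] p1(2) quad_q[OF that] by (auto simp: e_def split: if_splits)
    show False
    proof (cases "\<forall>j<n. p0 j = \<zero>")
      case True
      then have k: "k = Suc (n div 2)"
        using ge2.prems(3)[OF p0(1,3)] p0(2) by auto
      have "z \<noteq> \<zero>" using True p0(2,3) nz unfolding z_def by blast
      then have ez: "e \<otimes> z \<in> Units R" using ce by (simp add: field_Units integral_iff)
      \<comment> \<open>Here \<open>p0\<close> is a multiple of d, so \<open>quad R n (q t)\<close>
        stays equal to \<open>B\<close> and the colour 0 equation is linear in \<open>t\<close> with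
        slope \<open>e \<otimes> z\<close>; this is its root.\<close>
      define t where "t = inv (e \<otimes> z) \<otimes> (e \<otimes> e \<ominus> (e \<otimes> y \<oplus> B))"
      have t: "t \<in> carrier R" using ez ce unfolding t_def by simp
      have "e \<otimes> (y \<oplus> t \<otimes> z) \<oplus> B = (e \<otimes> z) \<otimes> t \<oplus> (e \<otimes> y \<oplus> B)"
        using ce t by (simp add: r_distr a_ac m_ac)
      also have "(e \<otimes> z) \<otimes> t = e \<otimes> e \<ominus> (e \<otimes> y \<oplus> B)"
        using ez ce unfolding t_def by (simp add: m_assoc[symmetric])
      also have "\<dots> \<oplus> (e \<otimes> y \<oplus> B) = e \<otimes> e"
        using ce by (simp add: minus_eq a_assoc l_neg)
      finally have "e \<otimes> (y \<oplus> t \<otimes> z) \<oplus> B = e \<otimes> e" .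
      moreover have "quad R n (q t) = B"
        unfolding B_def using True t cc by (intro quad_cong) (simp add: q_def)
      ultimately show False using colour_q[OF t] k by simp
    next
      case False
      then have k: "quad_colour R n p0 = k" using ge2.prems(3)[OF p0(1,3)] p0(2) by auto
      \<comment> \<open>Off the hyperplane only 0 and the fresh colour occur, and \<open>p0\<close>
        carries an old colour, so 0 is the only common value.\<close>
      then have k0: "k = 0"
        using quad_colour_le[of R n p0] colour_q[of \<zero>] by (auto split: if_splits)
      have "A \<noteq> \<zero>"
        unfolding A_def using k k0 False cc by (intro quad_nonzero) auto
      moreover obtain b where b: "b \<in> carrier R" "\<And>t. t \<in> carrier R \<Longrightarrow>
          quad R n (q t) = B \<oplus> t \<otimes> b \<oplus> (t \<otimes> t) \<otimes> A"
        using quad_add_scale[of p1 n p0] cc unfolding q_def A_def B_def by (auto simp: Pi_iff)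
      have "A = \<zero>"
      \<comment> \<open>The coefficients come from expanding the colour 0 equation at
        \<open>q t\<close> in powers of \<open>t\<close>.\<close>
      proof (rule quadratic_three_roots[of A "e \<otimes> z \<oplus> b" "e \<otimes> y \<oplus> B \<ominus> e \<otimes> e" s])
        fix t assume t: "t \<in> carrier R"
        have "e \<otimes> (y \<oplus> t \<otimes> z) \<oplus> (B \<oplus> t \<otimes> b \<oplus> (t \<otimes> t) \<otimes> A) = e \<otimes> e"
          using colour_q[OF t] b(2)[OF t] k0 by (auto split: if_splits)
        then have "e \<otimes> (y \<oplus> t \<otimes> z) \<oplus> (B \<oplus> t \<otimes> b \<oplus> (t \<otimes> t) \<otimes> A) \<ominus> e \<otimes> e = \<zero>"
          using ce by (simp add: minus_eq r_neg)
        then show "e \<otimes> y \<oplus> B \<ominus> e \<otimes> e \<oplus> t \<otimes> (e \<otimes> z \<oplus> b) \<oplus> (t \<otimes> t) \<otimes> A = \<zero>"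
          using ce b(1) t by (simp add: minus_eq r_distr a_ac m_ac)
      qed (use three ce b in auto)
      ultimately show False by simp
    qed
  qed
qed

section \<open>From vectors to points and lines of the projective space\<close>

definition point_of :: "nat \<Rightarrow> (nat \<Rightarrow> 'a) \<Rightarrow> (nat \<Rightarrow> 'a) set" where
  "point_of n w = (\<lambda>a. \<lambda>j\<in>{..<n}. a \<otimes> w j) ` carrier R"

text \<open>The choice of representative is harmless: nonzero vectors of a point differ by a nonzero
  scalar, which \<open>quad_colour_scale\<close> ignores.\<close>

definition point_colour :: "nat \<Rightarrow> (nat \<Rightarrow> 'a) set \<Rightarrow> nat" where
  "point_colour n P = quad_colour R n (SOME w. w \<in> P \<and> (\<exists>j<n. w j \<noteq> \<zero>))"

lemma lincomb_1:
  assumes "c 0 \<in> carrier R" "b 0 \<in> vecs R n"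
  shows "lincomb R n 1 c b = (\<lambda>j\<in>{..<n}. c 0 \<otimes> b 0 j)"
  unfolding lincomb_def
proof (rule restrict_ext)
  fix j assume "j \<in> {..<n}"
  then have "c 0 \<otimes> b 0 j \<in> carrier R" using assms unfolding vecs_def by auto
  then show "(\<Oplus>i\<in>{..<1}. c i \<otimes> b i j) = c 0 \<otimes> b 0 j" by (simp add: lessThan_Suc)
qed

lemma lincomb_2:
  assumes "c 0 \<in> carrier R" "c 1 \<in> carrier R" "b 0 \<in> vecs R n" "b 1 \<in> vecs R n"
  shows "lincomb R n 2 c b = (\<lambda>j\<in>{..<n}. c 0 \<otimes> b 0 j \<oplus> c 1 \<otimes> b 1 j)"
  unfolding lincomb_def
proof (rule restrict_ext)
  fix j assume "j \<in> {..<n}"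
  then have "c 0 \<otimes> b 0 j \<in> carrier R" "c 1 \<otimes> b 1 j \<in> carrier R"
    using assms unfolding vecs_def by auto
  then show "(\<Oplus>i\<in>{..<2}. c i \<otimes> b i j) = c 0 \<otimes> b 0 j \<oplus> c 1 \<otimes> b 1 j"
    by (simp add: lessThan_Suc numeral_2_eq_2 a_comm)
qed

lemma PG_points_eq: "PG_points R n = point_of n ` {w \<in> vecs R n. \<exists>j<n. w j \<noteq> \<zero>}"
proof -
  have span: "lin_span R n 1 b = point_of n (b 0)" if "b 0 \<in> vecs R n" for b
  proof -
    have "lin_span R n 1 b = (\<lambda>c. \<lambda>j\<in>{..<n}. c 0 \<otimes> b 0 j) ` ({..<1::nat} \<rightarrow> carrier R)"
      unfolding lin_span_def by (intro image_cong refl lincomb_1 that) auto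
    also have "\<dots> = (\<lambda>a. \<lambda>j\<in>{..<n}. a \<otimes> b 0 j) ` ((\<lambda>c. c 0) ` ({..<1::nat} \<rightarrow> carrier R))"
      by (simp add: image_image)
    also have "(\<lambda>c. c 0) ` ({..<1::nat} \<rightarrow> carrier R) = carrier R"
      by (auto intro!: image_eqI[where x = "\<lambda>_. _"])
    finally show ?thesis unfolding point_of_def .
  qed
  have indep: "lin_indep R n 1 b \<longleftrightarrow> (\<exists>j<n. b 0 j \<noteq> \<zero>)" if "b 0 \<in> vecs R n" for b
  proof -
    have c: "b 0 j \<in> carrier R" if "j < n" for j
      using \<open>b 0 \<in> vecs R n\<close> that unfolding vecs_def by auto
    have "lincomb R n 1 c b = zero_vec R n \<longleftrightarrow> (\<forall>j<n. c 0 \<otimes> b 0 j = \<zero>)"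
      if "c \<in> {..<1} \<rightarrow> carrier R" for c
    proof -
      have c0: "c 0 \<in> carrier R" using that by auto
      then show ?thesis
        unfolding lincomb_1[of c b n, OF c0 \<open>b 0 \<in> vecs R n\<close>] zero_vec_def
        by (auto simp: fun_eq_iff restrict_def)
    qed
    then have "lin_indep R n 1 b \<longleftrightarrow>
        (\<forall>c\<in>{..<1::nat} \<rightarrow> carrier R. (\<forall>j<n. c 0 \<otimes> b 0 j = \<zero>) \<longrightarrow> c 0 = \<zero>)"
      unfolding lin_indep_def by auto
    also have "\<dots> \<longleftrightarrow> (\<exists>j<n. b 0 j \<noteq> \<zero>)"
    proof
      assume "\<forall>c\<in>{..<1::nat} \<rightarrow> carrier R. (\<forall>j<n. c 0 \<otimes> b 0 j = \<zero>) \<longrightarrow> c 0 = \<zero>"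
      from bspec[OF this, of "\<lambda>_. \<one>"] show "\<exists>j<n. b 0 j \<noteq> \<zero>" using c by auto
    qed (use c in \<open>auto simp: integral_iff Pi_iff\<close>)
    finally show ?thesis .
  qed
  show ?thesis
    unfolding PG_points_def subspaces_of_dim_def
  proof (intro equalityI subsetI)
    fix P assume "P \<in> {lin_span R n 1 b | b. b \<in> {..<1} \<rightarrow> vecs R n \<and> lin_indep R n 1 b}"
    then show "P \<in> point_of n ` {w \<in> vecs R n. \<exists>j<n. w j \<noteq> \<zero>}"
      using span indep by (auto simp: Pi_iff)
  next
    fix P assume "P \<in> point_of n ` {w \<in> vecs R n. \<exists>j<n. w j \<noteq> \<zero>}"
    then obtain w where "w \<in> vecs R n" "\<exists>j<n. w j \<noteq> \<zero>" "P = point_of n w" by blast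
    then show "P \<in> {lin_span R n 1 b | b. b \<in> {..<1} \<rightarrow> vecs R n \<and> lin_indep R n 1 b}"
      using span[of "\<lambda>_. w"] indep[of "\<lambda>_. w"] by (intro CollectI exI[of _ "\<lambda>_. w"]) auto
  qed
qed

lemma point_colour_point_of:
  assumes w: "w \<in> vecs R n" "\<exists>j<n. w j \<noteq> \<zero>"
  shows "point_colour n (point_of n w) = quad_colour R n w"
proof -
  have c: "w \<in> {..<n} \<rightarrow> carrier R" using w(1) unfolding vecs_def by auto
  have "w = (\<lambda>j\<in>{..<n}. \<one> \<otimes> w j)"
    using w(1) c unfolding vecs_def by (auto simp: fun_eq_iff restrict_def PiE_def extensional_def Pi_iff)
  then have "w \<in> point_of n w" unfolding point_of_def by blast
  then have ex: "\<exists>x. x \<in> point_of n w \<and> (\<exists>j<n. x j \<noteq> \<zero>)" using w(2) by blast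
  define x where "x = (SOME x. x \<in> point_of n w \<and> (\<exists>j<n. x j \<noteq> \<zero>))"
  have x: "x \<in> point_of n w" "\<exists>j<n. x j \<noteq> \<zero>" using someI_ex[OF ex] unfolding x_def by auto
  then obtain a where a: "a \<in> carrier R" "x = (\<lambda>j\<in>{..<n}. a \<otimes> w j)" unfolding point_of_def by blast
  have a0: "a \<noteq> \<zero>" using x(2) a c by (auto simp: Pi_iff)
  have "quad_colour R n x = quad_colour R n (\<lambda>j. a \<otimes> w j)"
    using a by (intro quad_colour_cong) auto
  then show ?thesis
    using quad_colour_scale[OF a(1) a0 c] unfolding point_colour_def x_def by simp
qed

lemma line_colouring_point_colour:
  assumes three: "s \<in> carrier R" "s \<noteq> \<zero>" "s \<noteq> \<one>"
  shows "line_colouring R n (Suc (n div 2)) (point_colour n)"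
  unfolding line_colouring_def
proof (intro conjI ballI notI)
  show "point_colour n \<in> PG_points R n \<rightarrow> {..<Suc (n div 2)}"
    using quad_colour_le by (auto simp: point_colour_def less_Suc_eq_le)
next
  fix L assume "L \<in> PG_lines R n" and "monochromatic (point_colour n) L"
  then obtain b k where b: "b \<in> {..<2} \<rightarrow> vecs R n" "lin_indep R n 2 b"
    and k: "\<And>P. P \<in> PG_points R n \<Longrightarrow> P \<subseteq> lin_span R n 2 b \<Longrightarrow> point_colour n P = k"
    unfolding PG_lines_def subspaces_of_dim_def monochromatic_def by blast
  have b01: "b 0 \<in> vecs R n" "b 1 \<in> vecs R n" using b(1) by auto
  then have c: "b 0 j \<in> carrier R" "b 1 j \<in> carrier R" if "j < n" for j
    using that unfolding vecs_def by auto
  \<comment> \<open>The span consists of extensional functions, which pointwise combinations need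
    not preserve. Leaving the values beyond \<open>n\<close> free gives a set closed in the sense of
    \<open>no_monochromatic_plane\<close>.\<close>
  define U where "U = {w \<in> {..<n} \<rightarrow> carrier R. restrict w {..<n} \<in> lin_span R n 2 b}"
  have span: "x \<in> lin_span R n 2 b \<longleftrightarrow>
      (\<exists>a\<in>carrier R. \<exists>d\<in>carrier R. x = (\<lambda>j\<in>{..<n}. a \<otimes> b 0 j \<oplus> d \<otimes> b 1 j))" for x
  proof
    assume "x \<in> lin_span R n 2 b"
    then obtain c where "c \<in> {..<2} \<rightarrow> carrier R" "x = lincomb R n 2 c b"
      unfolding lin_span_def by blast
    then show "\<exists>a\<in>carrier R. \<exists>d\<in>carrier R. x = (\<lambda>j\<in>{..<n}. a \<otimes> b 0 j \<oplus> d \<otimes> b 1 j)"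
      using lincomb_2[of c b n] b01 by (intro bexI[of _ "c 0"] bexI[of _ "c 1"]) (auto simp: Pi_iff)
  next
    assume "\<exists>a\<in>carrier R. \<exists>d\<in>carrier R. x = (\<lambda>j\<in>{..<n}. a \<otimes> b 0 j \<oplus> d \<otimes> b 1 j)"
    then obtain a d where "a \<in> carrier R" "d \<in> carrier R"
      "x = (\<lambda>j\<in>{..<n}. a \<otimes> b 0 j \<oplus> d \<otimes> b 1 j)" by blast
    then show "x \<in> lin_span R n 2 b"
      unfolding lin_span_def using lincomb_2[of "\<lambda>i. if i = 0 then a else d" b n] b01
      by (intro image_eqI[of _ _ "\<lambda>i. if i = 0 then a else d"]) auto
  qed
  have closed: "(\<lambda>j. a \<otimes> u j \<oplus> d \<otimes> v j) \<in> U"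
    if ad: "a \<in> carrier R" "d \<in> carrier R" and uv: "u \<in> U" "v \<in> U" for a d u v
  proof -
    have cu: "u j \<in> carrier R" "v j \<in> carrier R" if "j < n" for j
      using uv that unfolding U_def by auto
    obtain a1 d1 a2 d2 where e: "a1 \<in> carrier R" "d1 \<in> carrier R" "a2 \<in> carrier R" "d2 \<in> carrier R"
      "restrict u {..<n} = (\<lambda>j\<in>{..<n}. a1 \<otimes> b 0 j \<oplus> d1 \<otimes> b 1 j)"
      "restrict v {..<n} = (\<lambda>j\<in>{..<n}. a2 \<otimes> b 0 j \<oplus> d2 \<otimes> b 1 j)"
      using uv unfolding U_def span by blast
    have "u j = a1 \<otimes> b 0 j \<oplus> d1 \<otimes> b 1 j" "v j = a2 \<otimes> b 0 j \<oplus> d2 \<otimes> b 1 j" if "j < n" for j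
      using fun_cong[OF e(5), of j] fun_cong[OF e(6), of j] that by auto
    then have "a \<otimes> u j \<oplus> d \<otimes> v j =
        (a \<otimes> a1 \<oplus> d \<otimes> a2) \<otimes> b 0 j \<oplus> (a \<otimes> d1 \<oplus> d \<otimes> d2) \<otimes> b 1 j" if "j < n" for j
      using that e(1-4) ad c[OF that] by (simp add: r_distr l_distr a_ac m_ac)
    then have "restrict (\<lambda>j. a \<otimes> u j \<oplus> d \<otimes> v j) {..<n} \<in> lin_span R n 2 b"
      unfolding span using ad e(1-4)
      by (intro bexI[of _ "a \<otimes> a1 \<oplus> d \<otimes> a2"] bexI[of _ "a \<otimes> d1 \<oplus> d \<otimes> d2"])
         (auto simp: fun_eq_iff restrict_def)
    then show ?thesis unfolding U_def using ad cu by auto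
  qed
  show False
  proof (rule no_monochromatic_plane[OF three, of U n "b 0" "b 1" k])
    show "w \<in> {..<n} \<rightarrow> carrier R" if "w \<in> U" for w using that unfolding U_def by blast
    have "restrict (b 0) {..<n} \<in> lin_span R n 2 b" unfolding span
      using c by (intro bexI[of _ \<one>] bexI[of _ \<zero>]) (auto simp: fun_eq_iff restrict_def)
    then show "b 0 \<in> U" unfolding U_def using c by auto
    have "restrict (b 1) {..<n} \<in> lin_span R n 2 b" unfolding span
      using c by (intro bexI[of _ \<zero>] bexI[of _ \<one>]) (auto simp: fun_eq_iff restrict_def)
    then show "b 1 \<in> U" unfolding U_def using c by auto
    show "indep_pair n (b 0) (b 1)"
      unfolding indep_pair_def
    proof (intro ballI impI)
      fix a d assume ad: "a \<in> carrier R" "d \<in> carrier R" "\<forall>j<n. a \<otimes> b 0 j \<oplus> d \<otimes> b 1 j = \<zero>"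
      let ?c = "\<lambda>i::nat. if i = 0 then a else d"
      have "lincomb R n 2 ?c b = zero_vec R n"
        using lincomb_2[of ?c b n] b01 ad by (auto simp: zero_vec_def fun_eq_iff restrict_def)
      moreover have "?c \<in> {..<2} \<rightarrow> carrier R" using ad by auto
      ultimately have "\<forall>i<2. ?c i = \<zero>" using b(2) unfolding lin_indep_def by blast
      from this[rule_format, of 0] this[rule_format, of 1] show "a = \<zero> \<and> d = \<zero>" by auto
    qed
    show "quad_colour R n w = k" if w: "w \<in> U" "\<exists>j<n. w j \<noteq> \<zero>" for w
    proof -
      define x where "x = restrict w {..<n}"
      have x: "x \<in> vecs R n" "\<exists>j<n. x j \<noteq> \<zero>"
        using w unfolding U_def x_def vecs_def by auto
      have "point_of n x \<subseteq> lin_span R n 2 b"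
      proof
        fix y assume "y \<in> point_of n x"
        then obtain a where a: "a \<in> carrier R" "y = (\<lambda>j\<in>{..<n}. a \<otimes> x j)"
          unfolding point_of_def by blast
        \<comment> \<open>The zero summand turns scaling into an instance of
          \<open>closed\<close>.\<close>
        have "restrict (\<lambda>j. a \<otimes> w j \<oplus> \<zero> \<otimes> w j) {..<n} \<in> lin_span R n 2 b"
          using closed[OF a(1) _ w(1) w(1), of \<zero>] unfolding U_def by simp
        moreover have "restrict (\<lambda>j. a \<otimes> w j \<oplus> \<zero> \<otimes> w j) {..<n} = y"
          using a w(1) unfolding U_def x_def by (auto simp: fun_eq_iff restrict_def Pi_iff)
        ultimately show "y \<in> lin_span R n 2 b" by simp
      qed
      then have "point_colour n (point_of n x) = k"
        using k x unfolding PG_points_eq by blast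
      then have "quad_colour R n x = k" using point_colour_point_of[OF x] by simp
      moreover have "quad_colour R n x = quad_colour R n w"
        unfolding x_def by (intro quad_colour_cong) simp
      ultimately show ?thesis by simp
    qed
  qed (use closed in auto)
qed

section \<open>The bound on the chromatic number\<close>

lemma chi_le:
  assumes "order R \<ge> 3"
  shows "chi R n \<le> Suc (n div 2)"
proof -
  \<comment> \<open>Three elements leave room for the \<open>s\<close> different from 0 and 1 that
    the quadratic argument evaluates at.\<close>
  have "\<not> carrier R \<subseteq> {\<zero>, \<one>}"
  proof
    assume "carrier R \<subseteq> {\<zero>, \<one>}"
    then have "card (carrier R) \<le> card {\<zero>, \<one>}" by (intro card_mono) auto
    also have "\<dots> \<le> 2" by (simp add: card_insert_if)
    finally show False using assms unfolding order_def by simp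
  qed
  then obtain s where "s \<in> carrier R" "s \<noteq> \<zero>" "s \<noteq> \<one>" by blast
  then have "\<exists>f. line_colouring R n (Suc (n div 2)) f"
    using line_colouring_point_colour by blast
  then show ?thesis unfolding chi_def by (rule Least_le)
qed

end

theorem theorem1p4:
  shows
    "(\<forall>q::nat. primepow q \<and> q \<ge> 5 \<longrightarrow>
        (\<exists>C::real. \<forall>(F :: ('a, 'm) ring_scheme) (n::nat).
           field F \<and> order F = q \<and> n \<ge> 1 \<longrightarrow> real (chi F n) \<le> real n / 2 + C)) \<and>
     (\<forall>q::nat. q \<in> {3, 4} \<longrightarrow>
        (\<exists>C::real. \<forall>(F :: ('a, 'm) ring_scheme) (n::nat).
           field F \<and> order F = q \<and> n \<ge> 1 \<longrightarrow> real (chi F n) \<le> 3 * real n / 5 + C))"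
proof -
  \<comment> \<open>This one bound serves both halves with constant 1, since n/2 is at most
    3n/5.\<close>
  have bound: "real (chi F n) \<le> real n / 2 + 1"
    if "field F" "order F \<ge> 3" for F :: "('a, 'm) ring_scheme" and n :: nat
  proof -
    have "real (chi F n) \<le> real (Suc (n div 2))"
      using field.chi_le[OF that] by (simp only: of_nat_le_iff)
    also have "\<dots> \<le> real n / 2 + 1" by simp
    finally show ?thesis .
  qed
  show ?thesis
  proof (intro conjI allI impI exI[of _ 1])
    fix q n :: nat and F :: "('a, 'm) ring_scheme"
    assume "primepow q \<and> q \<ge> 5" "field F \<and> order F = q \<and> n \<ge> 1"
    then show "real (chi F n) \<le> real n / 2 + 1" using bound by simp
  next
    fix q n :: nat and F :: "('a, 'm) ring_scheme"
    assume "q \<in> {3, 4}" "field F \<and> order F = q \<and> n \<ge> 1"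
    then have "real (chi F n) \<le> real n / 2 + 1" using bound by auto
    then show "real (chi F n) \<le> 3 * real n / 5 + 1" by simp
  qed
qed

end
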